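(* Let $M$ be a CG-lattice $L$-module and let $N$ be a proper element of $M$. Then the following statements are equivalent: (1) $N$ is a pseudo-primary element of $M$. (2) $(N:I_M)=(N:X)$ for every proper element $X\in M$ with $X\not\leqslant rad(N)$. (3) $(N:a)\leqslant rad(N)$ for every proper element $a\in L$ with $a>(N:I_M)$. (4) For every $r\in L_\ast$ and $K\in M_\ast$, if $rK\leqslant N$ then either $r\leqslant (N:I_M)$ or $K\leqslant rad(N)$.
   Context: A multiplicative lattice $L$ is a complete lattice (least element $0$, greatest element $1$) with a commutative, associative multiplication that distributes over arbitrary joins and has $1$ as identity. An element $a$ of a complete lattice is compact if $a\leqslant \bigvee X$ implies $a\leqslant x_1\vee\cdots\vee x_n$ for finitely many $x_i\in X$; $L_\ast$ is the set of compact elements of $L$. Standing assumption: every element of $L$ is a join of compact elements of $L$, $1$ is compact, and finite products of compact elements of $L$ are compact. An element $a\in L$ is proper if $a<1$. An $L$-module $M$ is a complete lattice (least element $O_M$, greatest element $I_M$) with a multiplication $L\times M\to M$, $(a,A)\mapsto aA$, such that $(\bigvee_\alpha a_\alpha)A=\bigvee_\alpha a_\alpha A$, $a(\bigvee_\alpha A_\alpha)=\bigvee_\alpha aA_\alpha$, $(ab)A=a(bA)$, $1A=A$, $0A=O_M$. $M_\ast$ is the set of compact elements of $M$; $M$ is a CG-lattice $L$-module if each element of $M$ is a join of compact elements of $M$. For $A,B\in M$ and $a\in L$, $(A:B)=\bigvee\{x\in L\mid xB\leqslant A\}\in L$ and $(A:a)=\bigvee\{X\in M\mid aX\leqslant A\}\in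 M$. $N\in M$ is proper if $N<I_M$. A proper $N\in M$ is prime if for all $a\in L$, $X\in M$, $aX\leqslant N$ implies $X\leqslant N$ or $aI_M\leqslant N$. For a proper $N$, $rad(N)=\bigwedge\{P\in M\mid P\text{ is prime and }N\leqslant P\}$ (the empty meet is $I_M$). A proper $N\in M$ is pseudo-primary if for all $a\in L$, $X\in M$, $aX\leqslant N$ implies $a\leqslant (N:I_M)$ or $X\leqslant rad(N)$. *)

theory Defs
  imports Main
begin

context complete_lattice
begin

text \<open>
  The finite subfamily may be empty, so that the least element is compact; for nonempty
  \<open>X\<close> this makes no difference.
\<close>

definition compact_element :: "'a \<Rightarrow> bool" where
  "compact_element a \<longleftrightarrow>
     (\<forall>X. a \<le> Sup X \<longrightarrow> (\<exists>F. finite F \<and> F \<subseteq> X \<and> a \<le> Sup F))"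

definition join_of_compacts :: "'a \<Rightarrow> bool" where
  "join_of_compacts a \<longleftrightarrow> (\<exists>C. (\<forall>c\<in>C. compact_element c) \<and> a = Sup C)"

end

class multiplicative_lattice = complete_lattice + comm_monoid_mult +
  assumes one_eq_top: "1 = top"
    and mult_Sup_distrib: "a * Sup X = Sup ((\<lambda>x. a * x) ` X)"

text \<open>
  Compactness of \<open>1\<close> (the empty product) and of binary products amounts to
  compactness of all finite products of compact elements.
\<close>

class compact_multiplicative_lattice = multiplicative_lattice +
  assumes join_of_compacts: "join_of_compacts a"
    and compact_one: "compact_element 1"
    and compact_mult: "compact_element a \<Longrightarrow> compact_element b \<Longrightarrow> compact_element (a * b)"

locale lattice_module =
  fixes act :: "'l::compact_multiplicative_lattice \<Rightarrow> 'm::complete_lattice \<Rightarrow> 'm"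
  assumes act_Sup_left: "act (Sup S) A = Sup ((\<lambda>a. act a A) ` S)"
    and act_Sup_right: "act a (Sup T) = Sup ((\<lambda>A. act a A) ` T)"
    and act_mult: "act (a * b) A = act a (act b A)"
    and act_one: "act 1 A = A"
    and act_bot: "act bot A = bot"

locale cg_lattice_module = lattice_module act
  for act :: "'l::compact_multiplicative_lattice \<Rightarrow> 'm::complete_lattice \<Rightarrow> 'm" +
  assumes module_join_of_compacts: "join_of_compacts (A :: 'm)"

definition residual_by_module ::
    "('l::complete_lattice \<Rightarrow> 'm::complete_lattice \<Rightarrow> 'm) \<Rightarrow> 'm \<Rightarrow> 'm \<Rightarrow> 'l" where
  "residual_by_module act A B = Sup {x. act x B \<le> A}"

definition residual_by_lattice ::
    "('l::complete_lattice \<Rightarrow> 'm::complete_lattice \<Rightarrow> 'm) \<Rightarrow> 'm \<Rightarrow> 'l \<Rightarrow> 'm" where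
  "residual_by_lattice act A a = Sup {X. act a X \<le> A}"

definition proper :: "'a::complete_lattice \<Rightarrow> bool" where
  "proper a \<longleftrightarrow> a < top"

definition prime_element ::
    "('l::complete_lattice \<Rightarrow> 'm::complete_lattice \<Rightarrow> 'm) \<Rightarrow> 'm \<Rightarrow> bool" where
  "prime_element act N \<longleftrightarrow>
     proper N \<and> (\<forall>a X. act a X \<le> N \<longrightarrow> X \<le> N \<or> act a top \<le> N)"

definition module_rad ::
    "('l::complete_lattice \<Rightarrow> 'm::complete_lattice \<Rightarrow> 'm) \<Rightarrow> 'm \<Rightarrow> 'm" where
  "module_rad act N = Inf {P. prime_element act P \<and> N \<le> P}"

definition pseudo_primary ::
    "('l::complete_lattice \<Rightarrow> 'm::complete_lattice \<Rightarrow> 'm) \<Rightarrow> 'm \<Rightarrow> bool" where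
  "pseudo_primary act N \<longleftrightarrow>
     proper N \<and>
     (\<forall>a X. act a X \<le> N \<longrightarrow> a \<le> residual_by_module act N top \<or> X \<le> module_rad act N)"

end

theory Submission
  imports Defs
begin

text \<open>
  Both residuals are adjoints of the action: \<open>aX \<le> N\<close> iff \<open>a \<le> (N:X)\<close> iff \<open>X \<le> (N:a)\<close>.
  With this, (2) and (3) are rewritings of the pseudo-primary condition, once \<open>X\<close> is allowed to
  be the top element (where the condition is trivial) and \<open>a\<close> is replaced by
  \<open>a \<squnion> (N:I)\<close> (if this is 1, then \<open>X \<le> N \<le> rad N\<close>). For (4), if \<open>a \<not>\<le> (N:I)\<close>, then some
  compact \<open>r \<le> a\<close> already satisfies \<open>r \<not>\<le> (N:I)\<close>, and every compact \<open>K \<le> X\<close> then lies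
  below the radical.
\<close>

text \<open>An element that is a join of compacts is determined by the compacts below it. Read
  contrapositively, this supplies a compact witness for a failed inequality; both readings serve the
  compact criterion.\<close>

lemma join_of_compacts_le_iff:
  fixes a b :: "'a::complete_lattice"
  assumes "join_of_compacts a"
  shows "a \<le> b \<longleftrightarrow> (\<forall>c. compact_element c \<and> c \<le> a \<longrightarrow> c \<le> b)"
proof
  assume "a \<le> b"
  then show "\<forall>c. compact_element c \<and> c \<le> a \<longrightarrow> c \<le> b"
    by (blast intro: order_trans)
next
  assume below: "\<forall>c. compact_element c \<and> c \<le> a \<longrightarrow> c \<le> b"
  obtain C where C: "\<forall>c\<in>C. compact_element c" "a = Sup C"
    using assms unfolding join_of_compacts_def by blast
  show "a \<le> b"
    unfolding C(2)
  proof (rule Sup_least)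
    fix c assume "c \<in> C"
    then show "c \<le> b" using below C by (simp add: Sup_upper)
  qed
qed

lemma le_module_rad: "N \<le> module_rad act N"
  unfolding module_rad_def by (rule Inf_greatest) simp

context lattice_module
begin

lemma act_mono_left:
  assumes "a \<le> b"
  shows "act a X \<le> act b X"
proof -
  \<comment> \<open>Monotonicity comes from distributivity: \<open>b\<close> is the join of
    \<open>a\<close> and \<open>b\<close>, so \<open>act a X\<close> is a joinand of
    \<open>act b X\<close>.\<close>
  have "act b X = act (Sup {a, b}) X" using assms by (simp add: sup.absorb2)
  also have "\<dots> = sup (act a X) (act b X)" by (subst act_Sup_left) simp
  finally show ?thesis by (metis sup.cobounded1)
qed

lemma act_mono_right:
  assumes "X \<le> Y"
  shows "act a X \<le> act a Y"
proof -
  have "act a Y = act a (Sup {X, Y})" using assms by (simp add: sup.absorb2)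
  also have "\<dots> = sup (act a X) (act a Y)" by (subst act_Sup_right) simp
  finally show ?thesis by (metis sup.cobounded1)
qed

lemma act_le_iff_residual_by_module: "act a X \<le> N \<longleftrightarrow> a \<le> residual_by_module act N X"
proof
  assume "act a X \<le> N"
  then show "a \<le> residual_by_module act N X"
    unfolding residual_by_module_def by (simp add: Sup_upper)
next
  assume "a \<le> residual_by_module act N X"
  then have "act a X \<le> act (residual_by_module act N X) X" by (rule act_mono_left)
  \<comment> \<open>The residual itself belongs to the set whose join it is: the action distributes
    over that join, and every joinand is below \<open>N\<close>.\<close>
  also have "\<dots> \<le> N"
    unfolding residual_by_module_def act_Sup_left by (auto intro: Sup_least)
  finally show "act a X \<le> N" .
qed

lemma act_le_iff_residual_by_lattice: "act a X \<le> N \<longleftrightarrow> X \<le> residual_by_lattice act N a"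
proof
  assume "act a X \<le> N"
  then show "X \<le> residual_by_lattice act N a"
    unfolding residual_by_lattice_def by (simp add: Sup_upper)
next
  assume "X \<le> residual_by_lattice act N a"
  then have "act a X \<le> act a (residual_by_lattice act N a)" by (rule act_mono_right)
  also have "\<dots> \<le> N"
    unfolding residual_by_lattice_def act_Sup_right by (auto intro: Sup_least)
  finally show "act a X \<le> N" .
qed

text \<open>Residuals are antitone in the divisor. Hence one inequality suffices for the equality of
  residuals in (2).\<close>

lemma residual_by_module_top_le: "residual_by_module act N top \<le> residual_by_module act N X"
  by (metis act_le_iff_residual_by_module act_mono_right order_refl order_trans top_greatest)

lemma pseudo_primary_iff_residual_by_module:
  assumes "proper N"
  shows "pseudo_primary act N \<longleftrightarrow>
    (\<forall>X. proper X \<and> \<not> X \<le> module_rad act N \<longrightarrow>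
      residual_by_module act N top = residual_by_module act N X)"
  unfolding pseudo_primary_def
  \<comment> \<open>Forward, take \<open>a = residual_by_module act N X\<close>, for which
    \<open>act a X \<le> N\<close> by adjunction.\<close>
  by (metis assms act_le_iff_residual_by_module residual_by_module_top_le order_antisym
      order_refl proper_def top.not_eq_extremum)

lemma pseudo_primary_iff_residual_by_lattice:
  assumes "proper N"
  shows "pseudo_primary act N \<longleftrightarrow>
    (\<forall>a. proper a \<and> residual_by_module act N top < a \<longrightarrow>
      residual_by_lattice act N a \<le> module_rad act N)"
proof
  assume "pseudo_primary act N"
  then show "\<forall>a. proper a \<and> residual_by_module act N top < a \<longrightarrow>
      residual_by_lattice act N a \<le> module_rad act N"
    \<comment> \<open>The condition is applied to \<open>X = residual_by_lattice act N a\<close>;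
      strictness rules out its first alternative.\<close>
    unfolding pseudo_primary_def by (metis act_le_iff_residual_by_lattice order_refl leD)
next
  assume residual_le: "\<forall>a. proper a \<and> residual_by_module act N top < a \<longrightarrow>
      residual_by_lattice act N a \<le> module_rad act N"
  have "X \<le> module_rad act N"
    if "act a X \<le> N" and not_le: "\<not> a \<le> residual_by_module act N top" for a X
  proof -
    \<comment> \<open>Joining makes \<open>b\<close> strictly larger than the residual, as (3)
      demands. Still \<open>act b X \<le> N\<close>, because both joinands lie below
      \<open>residual_by_module act N X\<close>.\<close>
    define b where "b = sup a (residual_by_module act N top)"
    have "residual_by_module act N top < b"
      unfolding b_def using not_le by (simp add: less_le_not_le)
    moreover have "act b X \<le> N"
      unfolding b_def act_le_iff_residual_by_module
      using that(1) residual_by_module_top_le by (simp add: act_le_iff_residual_by_module)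
    ultimately show ?thesis
      \<comment> \<open>Either \<open>b\<close> is proper and (3) applies, or \<open>b = 1\<close>
        and \<open>act_one\<close> turns \<open>act b X \<le> N\<close> into
        \<open>X \<le> N\<close>.\<close>
      using residual_le le_module_rad[of N act] act_one[of X]
      by (metis act_le_iff_residual_by_lattice one_eq_top order_trans proper_def
          top.not_eq_extremum)
  qed
  then show "pseudo_primary act N"
    using assms unfolding pseudo_primary_def by blast
qed

end

lemma (in cg_lattice_module) pseudo_primary_iff_compact:
  assumes "proper N"
  shows "pseudo_primary act N \<longleftrightarrow>
    (\<forall>r K. compact_element r \<and> compact_element K \<and> act r K \<le> N \<longrightarrow>
      r \<le> residual_by_module act N top \<or> K \<le> module_rad act N)"
proof
  assume "pseudo_primary act N"
  then show "\<forall>r K. compact_element r \<and> compact_element K \<and> act r K \<le> N \<longrightarrow>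
      r \<le> residual_by_module act N top \<or> K \<le> module_rad act N"
    unfolding pseudo_primary_def by blast
next
  assume compact_case: "\<forall>r K. compact_element r \<and> compact_element K \<and> act r K \<le> N \<longrightarrow>
      r \<le> residual_by_module act N top \<or> K \<le> module_rad act N"
  have "X \<le> module_rad act N"
    if "act a X \<le> N" and not_le: "\<not> a \<le> residual_by_module act N top" for a X
  proof -
    obtain r where r: "compact_element r" "r \<le> a" "\<not> r \<le> residual_by_module act N top"
      using not_le join_of_compacts_le_iff[OF join_of_compacts] by blast
    \<comment> \<open>One fixed \<open>r\<close> serves all \<open>K\<close> below \<open>X\<close>,
      since \<open>act r K \<le> act a X\<close>.\<close>
    have "act r K \<le> N" if "K \<le> X" for K
      using act_mono_left[OF r(2)] act_mono_right[OF that] \<open>act a X \<le> N\<close>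
      by (meson order_trans)
    then show ?thesis
      using compact_case r join_of_compacts_le_iff[OF module_join_of_compacts] by blast
  qed
  then show "pseudo_primary act N"
    using assms unfolding pseudo_primary_def by blast
qed

theorem theorem2p8:
  fixes act :: "'l::compact_multiplicative_lattice \<Rightarrow> 'm::complete_lattice \<Rightarrow> 'm"
    and N :: 'm
  assumes "cg_lattice_module act"
    and "proper N"
  shows
    "(pseudo_primary act N \<longleftrightarrow>
        (\<forall>X::'m. proper X \<and> \<not> X \<le> module_rad act N \<longrightarrow>
           residual_by_module act N top = residual_by_module act N X)) \<and>
     (pseudo_primary act N \<longleftrightarrow>
        (\<forall>a::'l. proper a \<and> residual_by_module act N top < a \<longrightarrow>
           residual_by_lattice act N a \<le> module_rad act N)) \<and>
     (pseudo_primary act N \<longleftrightarrow>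
        (\<forall>(r::'l) (K::'m). compact_element r \<and> compact_element K \<and> act r K \<le> N \<longrightarrow>
           r \<le> residual_by_module act N top \<or> K \<le> module_rad act N))"
proof -
  interpret cg_lattice_module act by fact
  show ?thesis
    using assms(2) pseudo_primary_iff_residual_by_module pseudo_primary_iff_residual_by_lattice
      pseudo_primary_iff_compact by blast
qed

end
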